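(* Let $0<p<q$ be real numbers. The following four pseudometrics are mutually Borel-uniformly continuous bi-reducible: the Gromov-Hausdorff distance $\rho_{GH}$ on $\mathcal{M}$, its restriction $\rho_{GH}\upharpoonright \mathcal{M}_p$, its restriction $\rho_{GH}\upharpoonright \mathcal{M}^q$, and its restriction $\rho_{GH}\upharpoonright \mathcal{M}_p^q$. That is, for any two pseudometrics $\rho,\sigma$ from this list, $\rho\leq_{B,u}\sigma$ and $\sigma\leq_{B,u}\rho$.
   Context: $\mathcal{M}$ is the set of all metrics on $\mathbb{N}$, with the Polish topology inherited from $\mathbb{R}^{\mathbb{N}\times\mathbb{N}}$; $f\in\mathcal{M}$ is a code for the Polish metric space which is the completion of $(\mathbb{N},f)$. For positive reals $p,q$, $\mathcal{M}_p$, $\mathcal{M}^q$ and (if $p<q$) $\mathcal{M}_p^q$ denote the subspaces of $\mathcal{M}$ of metrics with values in $\{0\}\cup[p,\infty)$, $[0,q]$, and $\{0\}\cup[p,q]$, respectively. The Gromov-Hausdorff distance $\rho_{GH}(M,N)\in[0,\infty]$ of metric spaces $M,N$ is the infimum of the Hausdorff distances $\rho_H^X(\iota_M(M),\iota_N(N))$ over all metric spaces $X$ and isometric embeddings $\iota_M:M\to X$, $\iota_N:N\to X$, where $\rho_H^X(A,B)=\max\{\sup_{a\in A}d_X(a,B),\sup_{b\in B}d_X(b,A)\}$. For $f,g\in\mathcal{M}$, $\rho_{GH}(f,g)$ is the Gromov-Hausdorff distance between $(\mathbb{N},f)$ and $(\mathbb{N},g)$ (equivalently, between their completions). A pseudometric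 $\rho:X\times X\to[0,\infty]$ on a standard Borel space $X$ (the value $\infty$ is allowed) is analytic if $\{(x,y)\in X^2:\rho(x,y)<r\}$ is analytic for every $r>0$. For analytic pseudometrics $\rho_X$ on $X$ and $\rho_Y$ on $Y$, a Borel-uniformly continuous reduction is a Borel function $f:X\to Y$ such that for every $\varepsilon>0$ there are $\delta_X>0$ and $\delta_Y>0$ such that for all $x,y\in X$: $\rho_X(x,y)<\delta_X\Rightarrow\rho_Y(f(x),f(y))<\varepsilon$, and $\rho_Y(f(x),f(y))<\delta_Y\Rightarrow\rho_X(x,y)<\varepsilon$. If such an $f$ exists we write $\rho_X\leq_{B,u}\rho_Y$. They are Borel-uniformly continuous bi-reducible if $\rho_X\leq_{B,u}\rho_Y$ and $\rho_Y\leq_{B,u}\rho_X$. *)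

theory Defs
  imports "HOL-Analysis.Analysis"
begin

section \<open>Gromov-Hausdorff distance\<close>

definition hausdorff_dist :: "('a \<Rightarrow> 'a \<Rightarrow> real) \<Rightarrow> 'a set \<Rightarrow> 'a set \<Rightarrow> ennreal" where
  "hausdorff_dist d A B =
     max (SUP a\<in>A. INF b\<in>B. ennreal (d a b)) (SUP b\<in>B. INF a\<in>A. ennreal (d b a))"

definition isometric_embedding ::
  "'a set \<Rightarrow> ('a \<Rightarrow> 'a \<Rightarrow> real) \<Rightarrow> 'b set \<Rightarrow> ('b \<Rightarrow> 'b \<Rightarrow> real) \<Rightarrow> ('a \<Rightarrow> 'b) \<Rightarrow> bool" where
  "isometric_embedding M d X dX i \<longleftrightarrow> i ` M \<subseteq> X \<and> (\<forall>x\<in>M. \<forall>y\<in>M. dX (i x) (i y) = d x y)"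

text \<open>A definition cannot quantify over types, so the ambient spaces range over all metric spaces
  whose carrier is a set of elements of the sum type of the two given types. Nothing is lost:
  by \<open>GH_dist_le_hausdorff_dist\<close> below, the value is a lower bound for the Hausdorff distances in
  metric spaces over any type.\<close>

definition GH_dist ::
  "'a set \<Rightarrow> ('a \<Rightarrow> 'a \<Rightarrow> real) \<Rightarrow> 'b set \<Rightarrow> ('b \<Rightarrow> 'b \<Rightarrow> real) \<Rightarrow> ennreal" where
  "GH_dist M d N e =
     Inf {hausdorff_dist dX (i ` M) (j ` N) | (X :: ('a + 'b) set) dX i j.
            Metric_space X dX \<and> isometric_embedding M d X dX i \<and> isometric_embedding N e X dX j}"

lemma GH_dist_le_hausdorff_dist:
  fixes Z :: "'c set" and i :: "'a \<Rightarrow> 'c" and j :: "'b \<Rightarrow> 'c"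
  assumes Z: "Metric_space Z dZ"
    and i: "isometric_embedding M d Z dZ i"
    and j: "isometric_embedding N e Z dZ j"
  shows "GH_dist M d N e \<le> hausdorff_dist dZ (i ` M) (j ` N)"
proof -
  define C where "C = i ` M \<union> j ` N"
  define f :: "'c \<Rightarrow> 'a + 'b" where
    "f z = (if z \<in> i ` M then Inl (inv_into M i z) else Inr (inv_into N j z))" for z
  have inj: "inj_on f C"
    unfolding inj_on_def C_def f_def
    by (auto split: if_splits dest: inv_into_injective)
  define g where "g = inv_into C f"
  have g: "g (f z) = z" if "z \<in> C" for z
    unfolding g_def using inj that by (rule inv_into_f_f)
  have CZ: "C \<subseteq> Z"
    using i j by (auto simp: C_def isometric_embedding_def)
  define dX where "dX = (\<lambda>x y. dZ (g x) (g y))"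
  interpret Z: Metric_space Z dZ by (rule Z)
  have X: "Metric_space (f ` C) dX"
  proof
    fix x y assume "x \<in> f ` C" "y \<in> f ` C"
    then show "dX x y = 0 \<longleftrightarrow> x = y"
      using CZ by (auto simp: dX_def g subset_eq)
  next
    fix x y z assume "x \<in> f ` C" "y \<in> f ` C" "z \<in> f ` C"
    then show "dX x z \<le> dX x y + dX y z"
      using CZ by (auto simp: dX_def g subset_eq intro: Z.triangle)
  qed (auto simp: dX_def Z.commute)
  have iX: "isometric_embedding M d (f ` C) dX (f \<circ> i)"
    using i by (auto simp: isometric_embedding_def dX_def C_def g)
  have jX: "isometric_embedding N e (f ` C) dX (f \<circ> j)"
    using j by (auto simp: isometric_embedding_def dX_def C_def g)
  have "hausdorff_dist dX ((f \<circ> i) ` M) ((f \<circ> j) ` N) = hausdorff_dist dZ (i ` M) (j ` N)"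
    by (simp add: hausdorff_dist_def image_image dX_def g C_def)
  then show ?thesis
    unfolding GH_dist_def using X iX jX by (intro Inf_lower) (metis (mono_tags, lifting) mem_Collect_eq)
qed


section \<open>Analytic pseudometrics and reductions\<close>

instance prod :: (polish_space, polish_space) polish_space ..

text \<open>Analytic subsets of a Polish space as projections of Borel sets along the Baire space.\<close>

definition analytic_set :: "'a::polish_space set \<Rightarrow> bool" where
  "analytic_set A \<longleftrightarrow> (\<exists>B \<in> sets (borel :: ('a \<times> (nat \<Rightarrow> nat)) measure). A = fst ` B)"

text \<open>Standard Borel spaces are presented as Borel subsets \<open>X\<close> of a Polish space. A subset of
  \<open>X \<times> X\<close> is then analytic in \<open>X \<times> X\<close> iff it is analytic in the ambient square.\<close>

definition analytic_pseudometric :: "'a::polish_space set \<Rightarrow> ('a \<Rightarrow> 'a \<Rightarrow> ennreal) \<Rightarrow> bool" where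
  "analytic_pseudometric X \<rho> \<longleftrightarrow>
     X \<in> sets borel \<and>
     (\<forall>x\<in>X. \<rho> x x = 0) \<and>
     (\<forall>x\<in>X. \<forall>y\<in>X. \<rho> x y = \<rho> y x) \<and>
     (\<forall>x\<in>X. \<forall>y\<in>X. \<forall>z\<in>X. \<rho> x z \<le> \<rho> x y + \<rho> y z) \<and>
     (\<forall>r::real. r > 0 \<longrightarrow> analytic_set {(x, y) \<in> X \<times> X. \<rho> x y < ennreal r})"

definition Borel_uc_reduction ::
  "'a::polish_space set \<Rightarrow> ('a \<Rightarrow> 'a \<Rightarrow> ennreal) \<Rightarrow>
   'b::polish_space set \<Rightarrow> ('b \<Rightarrow> 'b \<Rightarrow> ennreal) \<Rightarrow> ('a \<Rightarrow> 'b) \<Rightarrow> bool" where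
  "Borel_uc_reduction X \<rho>X Y \<rho>Y f \<longleftrightarrow>
     f \<in> restrict_space borel X \<rightarrow>\<^sub>M restrict_space borel Y \<and>
     (\<forall>\<epsilon>::real. \<epsilon> > 0 \<longrightarrow>
       (\<exists>\<delta>X::real. \<exists>\<delta>Y::real. \<delta>X > 0 \<and> \<delta>Y > 0 \<and>
         (\<forall>x\<in>X. \<forall>y\<in>X.
            (\<rho>X x y < ennreal \<delta>X \<longrightarrow> \<rho>Y (f x) (f y) < ennreal \<epsilon>) \<and>
            (\<rho>Y (f x) (f y) < ennreal \<delta>Y \<longrightarrow> \<rho>X x y < ennreal \<epsilon>))))"

definition Borel_uc_reducible ::
  "'a::polish_space set \<Rightarrow> ('a \<Rightarrow> 'a \<Rightarrow> ennreal) \<Rightarrow>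
   'b::polish_space set \<Rightarrow> ('b \<Rightarrow> 'b \<Rightarrow> ennreal) \<Rightarrow> bool" where
  "Borel_uc_reducible X \<rho>X Y \<rho>Y \<longleftrightarrow>
     analytic_pseudometric X \<rho>X \<and> analytic_pseudometric Y \<rho>Y \<and>
     (\<exists>f. Borel_uc_reduction X \<rho>X Y \<rho>Y f)"

definition Borel_uc_bireducible ::
  "'a::polish_space set \<Rightarrow> ('a \<Rightarrow> 'a \<Rightarrow> ennreal) \<Rightarrow>
   'b::polish_space set \<Rightarrow> ('b \<Rightarrow> 'b \<Rightarrow> ennreal) \<Rightarrow> bool" where
  "Borel_uc_bireducible X \<rho>X Y \<rho>Y \<longleftrightarrow>
     Borel_uc_reducible X \<rho>X Y \<rho>Y \<and> Borel_uc_reducible Y \<rho>Y X \<rho>X"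


section \<open>Spaces of metrics on the natural numbers\<close>

text \<open>The type \<open>nat \<times> nat \<Rightarrow> real\<close> carries the product topology.\<close>

definition metrics :: "(nat \<times> nat \<Rightarrow> real) set" where
  "metrics = {f. Metric_space UNIV (curry f)}"

definition metrics_ge :: "real \<Rightarrow> (nat \<times> nat \<Rightarrow> real) set" where
  "metrics_ge p = {f \<in> metrics. range f \<subseteq> {0} \<union> {p..}}"

definition metrics_le :: "real \<Rightarrow> (nat \<times> nat \<Rightarrow> real) set" where
  "metrics_le q = {f \<in> metrics. range f \<subseteq> {0..q}}"

definition metrics_between :: "real \<Rightarrow> real \<Rightarrow> (nat \<times> nat \<Rightarrow> real) set" where
  "metrics_between p q = {f \<in> metrics. range f \<subseteq> {0} \<union> {p..q}}"

definition \<rho>_GH :: "(nat \<times> nat \<Rightarrow> real) \<Rightarrow> (nat \<times> nat \<Rightarrow> real) \<Rightarrow> ennreal" where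
  "\<rho>_GH f g = GH_dist UNIV (curry f) UNIV (curry g)"

end

theory Submission
  imports Defs
begin

text \<open>
  All four spaces lie between \<^term>\<open>metrics_between p q\<close> and \<^term>\<open>metrics\<close>, and the restriction of
  a reduction to a smaller domain, viewed in a larger target, is again a reduction. Hence a single
  reduction, of the Gromov-Hausdorff distance on all metrics to the one on metrics with values in
  \<open>{0} \<union> [p, q]\<close>, gives all the reductions between the four spaces. It is enough to map into values
  \<open>{0} \<union> [p, p + h]\<close> with \<open>h \<le> p\<close>; then every symmetric function with such values that vanishes
  exactly on the diagonal is a metric, so there is complete freedom in choosing the distances.

  The Gromov-Hausdorff distance is below \<open>r\<close> iff some correspondence between the two spaces has
  distortion at most \<open>2 s\<close> for some \<open>s < r\<close> (\<open>GH_dist_less_iff\<close>). This makes the distance a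
  pseudometric, and, since a correspondence between countable sets can be enumerated by a point of the
  Baire space, an analytic one (\<open>analytic_pseudometric_\<rho>_GH\<close>).

  Two obstacles separate general metrics from metrics with values in \<open>{0} \<union> [p, p + h]\<close>. First, a
  correspondence of distortion below \<open>p\<close> between \<open>p\<close>-separated spaces is a bijection, whereas
  between general spaces it need not be. The remedy is to replace every point of the original space
  by infinitely many copies: any correspondence lifts to a bijection of the copies
  (\<open>bij_along_correspondence\<close>). Second, the distances are unbounded, and no bounded function
  of a real \<open>t \<ge> 0\<close> has a uniformly continuous inverse. The remedy is to record the slices \<open>max 0 (min 1 (t - i))\<close> for
  all \<open>i\<close>: if all slices of \<open>s\<close> and \<open>t\<close> are close, so are \<open>s\<close> and \<open>t\<close>
  (\<open>abs_diff_le_if_slices_close\<close>).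

  To store all slices, every copy \<open>x\<close> of a point becomes a ladder of points \<open>(x, 0), (x, 1), \<dots>\<close>.
  The distance of \<open>(x, i)\<close> and \<open>(y, i)\<close> is \<open>p\<close> plus \<open>h / 2\<close> times the \<open>i\<close>-th slice of the distance
  between \<open>x\<close> and \<open>y\<close>, consecutive points of one ladder have the large distance \<open>p + h\<close>, and all
  other distances are \<open>p\<close>. A bijection that nearly preserves these distances preserves adjacency in
  ladders because of the gap between \<open>p + h / 2\<close> and \<open>p + h\<close>, and one-way infinite paths are rigid,
  so it carries whole ladders to ladders and keeps heights (\<open>rung_adjacent_automorphism\<close>). Therefore it matches
  slices with the same index, and the original distances can be recovered up to a small error
  (\<open>ladder_dist_recover\<close>).
\<close>

section \<open>The Gromov-Hausdorff distance through correspondences\<close>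

definition correspondence_distortion_le ::
  "'a set \<Rightarrow> ('a \<Rightarrow> 'a \<Rightarrow> real) \<Rightarrow> 'b set \<Rightarrow> ('b \<Rightarrow> 'b \<Rightarrow> real) \<Rightarrow> ('a \<times> 'b) set \<Rightarrow> real \<Rightarrow> bool" where
  "correspondence_distortion_le M d N e R c \<longleftrightarrow>
     fst ` R = M \<and> snd ` R = N \<and>
     (\<forall>(x, y) \<in> R. \<forall>(x', y') \<in> R. \<bar>d x x' - e y y'\<bar> \<le> c)"

lemma correspondence_distortion_leD:
  assumes "correspondence_distortion_le M d N e R c"
  shows "(x, y) \<in> R \<Longrightarrow> x \<in> M"
    and "(x, y) \<in> R \<Longrightarrow> y \<in> N"
    and "x \<in> M \<Longrightarrow> \<exists>y. (x, y) \<in> R"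
    and "y \<in> N \<Longrightarrow> \<exists>x. (x, y) \<in> R"
    and "(x, y) \<in> R \<Longrightarrow> (x', y') \<in> R \<Longrightarrow> \<bar>d x x' - e y y'\<bar> \<le> c"
  using assms unfolding correspondence_distortion_le_def by force+

lemma correspondence_distortion_leI:
  assumes "R \<subseteq> M \<times> N"
    and "\<And>x. x \<in> M \<Longrightarrow> \<exists>y. (x, y) \<in> R"
    and "\<And>y. y \<in> N \<Longrightarrow> \<exists>x. (x, y) \<in> R"
    and "\<And>x y x' y'. (x, y) \<in> R \<Longrightarrow> (x', y') \<in> R \<Longrightarrow> \<bar>d x x' - e y y'\<bar> \<le> c"
  shows "correspondence_distortion_le M d N e R c"
proof -
  have "fst ` R = M" "snd ` R = N"
    using assms(1-3) by (auto simp: image_iff Bex_def)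
  then show ?thesis
    using assms(4) unfolding correspondence_distortion_le_def by blast
qed

text \<open>The distance between points on different sides when the two spaces are glued by joining each
  pair in \<open>R\<close> with a bridge of length \<open>s\<close>.\<close>

definition cross_dist ::
  "('a \<Rightarrow> 'a \<Rightarrow> real) \<Rightarrow> ('b \<Rightarrow> 'b \<Rightarrow> real) \<Rightarrow> ('a \<times> 'b) set \<Rightarrow> real \<Rightarrow> 'a \<Rightarrow> 'b \<Rightarrow> real" where
  "cross_dist d e R s x y = (INF (u, v) \<in> R. d x u + s + e v y)"

fun glued_dist ::
  "('a \<Rightarrow> 'a \<Rightarrow> real) \<Rightarrow> ('b \<Rightarrow> 'b \<Rightarrow> real) \<Rightarrow> ('a \<times> 'b) set \<Rightarrow> real \<Rightarrow> 'a + 'b \<Rightarrow> 'a + 'b \<Rightarrow> real" where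
  "glued_dist d e R s (Inl x) (Inl x') = d x x'"
| "glued_dist d e R s (Inr y) (Inr y') = e y y'"
| "glued_dist d e R s (Inl x) (Inr y) = cross_dist d e R s x y"
| "glued_dist d e R s (Inr y) (Inl x) = cross_dist d e R s x y"

text \<open>A path crossing two bridges pays \<open>2 * s\<close>, which is at least what it can gain from the distortion
  of \<open>R\<close>; so the bridges create no shortcuts inside either space.\<close>

lemma Metric_space_glued_dist:
  assumes M: "Metric_space M d" and N: "Metric_space N e" and "M \<noteq> {}" and "0 < s"
    and R: "correspondence_distortion_le M d N e R (2 * s)"
  shows "Metric_space (Inl ` M \<union> Inr ` N) (glued_dist d e R s)"
proof -
  interpret M: Metric_space M d by (rule M)
  interpret N: Metric_space N e by (rule N)
  note RD = correspondence_distortion_leD[OF R]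
  define D where "D = cross_dist d e R s"
  have D_le: "D x y \<le> d x u + s + e v y" if "(u, v) \<in> R" for x y u v
    unfolding D_def cross_dist_def using that \<open>0 < s\<close>
    by (intro cINF_lower2[of _ _ "(u, v)"] bdd_belowI2[of _ 0]) (auto intro!: add_nonneg_nonneg)
  have D_ge: "c \<le> D x y" if "x \<in> M" "\<And>u v. (u, v) \<in> R \<Longrightarrow> c \<le> d x u + s + e v y" for c x y
    unfolding D_def cross_dist_def using that RD(3)[of x] by (intro cINF_greatest) auto
  have D_pos: "0 < D x y" if "x \<in> M" for x y
    using D_ge[of x s y] that \<open>0 < s\<close> by fastforce
  have D_nonneg: "0 \<le> D x y" for x y
    unfolding D_def cross_dist_def using \<open>0 < s\<close> \<open>M \<noteq> {}\<close> RD(3)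
    by (intro cINF_greatest) (auto intro!: add_nonneg_nonneg)
  have tri1: "D x y \<le> d x x' + D x' y" if "x \<in> M" "x' \<in> M" "y \<in> N" for x x' y
  proof -
    have "D x y - d x x' \<le> D x' y"
    proof (rule D_ge[OF that(2)])
      fix u v assume uv: "(u, v) \<in> R"
      show "D x y - d x x' \<le> d x' u + s + e v y"
        using D_le[OF uv, of x y] M.triangle[OF that(1,2) RD(1)[OF uv]] by linarith
    qed
    then show ?thesis by linarith
  qed
  have tri2: "D x y \<le> D x y' + e y' y" if "x \<in> M" "y \<in> N" "y' \<in> N" for x y y'
  proof -
    have "D x y - e y' y \<le> D x y'"
    proof (rule D_ge[OF that(1)])
      fix u v assume uv: "(u, v) \<in> R"
      show "D x y - e y' y \<le> d x u + s + e v y'"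
        using D_le[OF uv, of x y] N.triangle[OF RD(2)[OF uv] that(3,2)] by linarith
    qed
    then show ?thesis by linarith
  qed
  have tri1': "D x y \<le> D x' y + d x' x" if "x \<in> M" "x' \<in> M" "y \<in> N" for x x' y
    using tri1[OF that] M.commute[of x x'] by simp
  have tri2': "D x y \<le> e y y' + D x y'" if "x \<in> M" "y \<in> N" "y' \<in> N" for x y y'
    using tri2[OF that] N.commute[of y y'] by simp
  have tri3: "d x x' \<le> D x y + D x' y" if "x \<in> M" "x' \<in> M" "y \<in> N" for x x' y
  proof -
    have "d x x' - D x y \<le> D x' y"
    proof (rule D_ge[OF that(2)])
      fix u' v' assume uv': "(u', v') \<in> R"
      have "d x x' - (d x' u' + s + e v' y) \<le> D x y"
      proof (rule D_ge[OF that(1)])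
        fix u v assume uv: "(u, v) \<in> R"
        have "d x x' \<le> d x u + d u u' + d x' u'"
          using M.triangle[of x u x'] M.triangle[of u u' x'] that RD(1)[OF uv] RD(1)[OF uv']
            M.commute[of x' u'] by linarith
        moreover have "d u u' \<le> e v v' + 2 * s"
          using RD(5)[OF uv uv'] by linarith
        moreover have "e v v' \<le> e v y + e v' y"
          using N.triangle[of v y v'] N.commute[of v' y] that RD(2)[OF uv] RD(2)[OF uv'] by simp
        ultimately show "d x x' - (d x' u' + s + e v' y) \<le> d x u + s + e v y" by linarith
      qed
      then show "d x x' - D x y \<le> d x' u' + s + e v' y" by linarith
    qed
    then show ?thesis by linarith
  qed
  have tri4: "e y y' \<le> D x y + D x y'" if "x \<in> M" "y \<in> N" "y' \<in> N" for x y y'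
  proof -
    have "e y y' - D x y \<le> D x y'"
    proof (rule D_ge[OF that(1)])
      fix u' v' assume uv': "(u', v') \<in> R"
      have "e y y' - (d x u' + s + e v' y') \<le> D x y"
      proof (rule D_ge[OF that(1)])
        fix u v assume uv: "(u, v) \<in> R"
        have "e y y' \<le> e v y + e v v' + e v' y'"
          using N.triangle[of y v y'] N.triangle[of v v' y'] that RD(2)[OF uv] RD(2)[OF uv']
            N.commute[of y v] by linarith
        moreover have "e v v' \<le> d u u' + 2 * s"
          using RD(5)[OF uv uv'] by linarith
        moreover have "d u u' \<le> d x u + d x u'"
          using M.triangle[of u x u'] M.commute[of u x] that RD(1)[OF uv] RD(1)[OF uv'] by simp
        ultimately show "e y y' - (d x u' + s + e v' y') \<le> d x u + s + e v y" by linarith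
      qed
      then show "e y y' - D x y \<le> d x u' + s + e v' y'" by linarith
    qed
    then show ?thesis by linarith
  qed
  show ?thesis
  proof
    show "0 \<le> glued_dist d e R s a b" for a b
      by (cases a; cases b) (auto simp: D_nonneg[unfolded D_def])
    show "glued_dist d e R s a b = glued_dist d e R s b a" for a b
      by (cases a; cases b) (simp_all add: M.commute N.commute)
    fix a b assume ab: "a \<in> Inl ` M \<union> Inr ` N" "b \<in> Inl ` M \<union> Inr ` N"
    then show "glued_dist d e R s a b = 0 \<longleftrightarrow> a = b"
      by (auto simp: D_pos[unfolded D_def, THEN less_imp_neq, symmetric])
    fix c assume c: "c \<in> Inl ` M \<union> Inr ` N"
    show "glued_dist d e R s a c \<le> glued_dist d e R s a b + glued_dist d e R s b c"
      using ab c tri1 tri1' tri2 tri2' tri3 tri4 unfolding D_def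
      by (auto simp: M.triangle N.triangle)
  qed
qed


lemma GH_dist_le_if_correspondence:
  assumes M: "Metric_space M d" and N: "Metric_space N e" and "M \<noteq> {}" and "0 < s"
    and R: "correspondence_distortion_le M d N e R (2 * s)"
  shows "GH_dist M d N e \<le> ennreal s"
proof -
  interpret M: Metric_space M d by (rule M)
  interpret N: Metric_space N e by (rule N)
  note RD = correspondence_distortion_leD[OF R]
  have cross: "cross_dist d e R s x y \<le> s" if "(x, y) \<in> R" for x y
    unfolding cross_dist_def using that RD(1,2)[OF that] \<open>0 < s\<close>
    by (intro cINF_lower2[of _ _ "(x, y)"] bdd_belowI2[of _ 0]) (auto intro!: add_nonneg_nonneg)
  have "GH_dist M d N e \<le> hausdorff_dist (glued_dist d e R s) (Inl ` M) (Inr ` N)"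
    by (rule GH_dist_le_hausdorff_dist[OF Metric_space_glued_dist[OF assms]])
      (auto simp: isometric_embedding_def)
  also have "\<dots> \<le> ennreal s"
    unfolding hausdorff_dist_def
  proof (intro max.boundedI SUP_least)
    fix a :: "'a + 'b" assume "a \<in> Inl ` M"
    then obtain x y where "a = Inl x" "(x, y) \<in> R" using RD(3) by blast
    then show "(INF b\<in>Inr ` N. ennreal (glued_dist d e R s a b)) \<le> ennreal s"
      using RD(2) cross by (intro INF_lower2[of "Inr y"]) (auto intro!: ennreal_leI)
  next
    fix b :: "'a + 'b" assume "b \<in> Inr ` N"
    then obtain x y where "b = Inr y" "(x, y) \<in> R" using RD(4) by blast
    then show "(INF a\<in>Inl ` M. ennreal (glued_dist d e R s b a)) \<le> ennreal s"
      using RD(1) cross by (intro INF_lower2[of "Inl x"]) (auto intro!: ennreal_leI)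
  qed
  finally show ?thesis .
qed

text \<open>Pairs of points of Hausdorff-close sets that lie within \<open>s\<close> of each other form a
  correspondence, whose distortion is bounded by the triangle inequality.\<close>

lemma correspondence_if_GH_dist_less:
  assumes less: "GH_dist M d N e < ennreal r"
  obtains s R where "0 < s" "s < r" "correspondence_distortion_le M d N e R (2 * s)"
proof -
  obtain X :: "('a + 'b) set" and dX i j where X: "Metric_space X dX"
    and i: "isometric_embedding M d X dX i" and j: "isometric_embedding N e X dX j"
    and H: "hausdorff_dist dX (i ` M) (j ` N) < ennreal r"
    using less unfolding GH_dist_def Inf_less_iff by blast
  interpret X: Metric_space X dX by (rule X)
  obtain t where t: "hausdorff_dist dX (i ` M) (j ` N) < t" "t < ennreal r"
    using dense[OF H] by blast
  define s where "s = enn2real t"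
  have t_eq: "t = ennreal s"
    using t(2) less_le_trans[OF t(2) top_greatest] by (simp add: s_def)
  have "0 < s"
    using t(1) unfolding t_eq by (metis ennreal_neg linorder_not_less not_less_zero)
  have "s < r"
    using t(2) \<open>0 < s\<close> unfolding t_eq by (simp add: ennreal_less_iff)
  define R where "R = {(x, y) \<in> M \<times> N. dX (i x) (j y) < s}"
  have "\<exists>y\<in>N. dX (i x) (j y) < s" if "x \<in> M" for x
  proof -
    have "(INF b\<in>j ` N. ennreal (dX (i x) b)) \<le> hausdorff_dist dX (i ` M) (j ` N)"
      using that unfolding hausdorff_dist_def
      by (intro max.coboundedI1 SUP_upper2[of "i x"]) auto
    also note t(1)[unfolded t_eq]
    finally have "(INF b\<in>j ` N. ennreal (dX (i x) b)) < ennreal s" .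
    then show ?thesis by (auto simp: INF_less_iff ennreal_less_iff)
  qed
  moreover have "\<exists>x\<in>M. dX (i x) (j y) < s" if "y \<in> N" for y
  proof -
    have "(INF a\<in>i ` M. ennreal (dX (j y) a)) \<le> hausdorff_dist dX (i ` M) (j ` N)"
      using that unfolding hausdorff_dist_def
      by (intro max.coboundedI2 SUP_upper2[of "j y"]) auto
    also note t(1)[unfolded t_eq]
    finally have "(INF a\<in>i ` M. ennreal (dX (j y) a)) < ennreal s" .
    then show ?thesis by (auto simp: INF_less_iff ennreal_less_iff X.commute)
  qed
  moreover have "\<bar>d x x' - e y y'\<bar> \<le> 2 * s" if "(x, y) \<in> R" "(x', y') \<in> R" for x x' y y'
  proof -
    have X4: "i x \<in> X" "i x' \<in> X" "j y \<in> X" "j y' \<in> X"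
      and eqs: "dX (i x) (i x') = d x x'" "dX (j y) (j y') = e y y'"
      using that i j by (auto simp: R_def isometric_embedding_def)
    have *: "dX (i x) (j y) < s" "dX (i x') (j y') < s"
      using that by (auto simp: R_def)
    have "d x x' \<le> dX (i x) (j y) + e y y' + dX (i x') (j y')"
      using X.triangle[OF X4(1,3,2)] X.triangle[OF X4(3,4,2)] X.commute[of "i x'" "j y'"] eqs by simp
    moreover have "e y y' \<le> dX (i x) (j y) + d x x' + dX (i x') (j y')"
      using X.triangle[OF X4(3,1,4)] X.triangle[OF X4(1,2,4)] X.commute[of "i x" "j y"] eqs by simp
    ultimately show ?thesis
      using * by linarith
  qed
  moreover have "R \<subseteq> M \<times> N"
    by (auto simp: R_def)
  ultimately have "correspondence_distortion_le M d N e R (2 * s)"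
    by (intro correspondence_distortion_leI) (auto simp: R_def Bex_def)
  with \<open>0 < s\<close> \<open>s < r\<close> show ?thesis by (rule that)
qed

lemma GH_dist_less_iff:
  assumes "Metric_space M d" "Metric_space N e" "M \<noteq> {}"
  shows "GH_dist M d N e < ennreal r \<longleftrightarrow>
    (\<exists>s R. 0 < s \<and> s < r \<and> correspondence_distortion_le M d N e R (2 * s))"
proof (rule iffI)
  assume "GH_dist M d N e < ennreal r"
  then obtain s R where "0 < s" "s < r" "correspondence_distortion_le M d N e R (2 * s)"
    by (rule correspondence_if_GH_dist_less)
  then show "\<exists>s R. 0 < s \<and> s < r \<and> correspondence_distortion_le M d N e R (2 * s)"
    by blast
next
  assume "\<exists>s R. 0 < s \<and> s < r \<and> correspondence_distortion_le M d N e R (2 * s)"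
  then obtain s R where "0 < s" "s < r" and R: "correspondence_distortion_le M d N e R (2 * s)"
    by blast
  have "GH_dist M d N e \<le> ennreal s"
    by (rule GH_dist_le_if_correspondence[OF assms \<open>0 < s\<close> R])
  also have "\<dots> < ennreal r"
    using \<open>0 < s\<close> \<open>s < r\<close> by (simp add: ennreal_less_iff)
  finally show "GH_dist M d N e < ennreal r" .
qed

lemma correspondence_distortion_le_converse:
  assumes "correspondence_distortion_le M d N e R c"
  shows "correspondence_distortion_le N e M d (R\<inverse>) c"
  using correspondence_distortion_leD[OF assms]
  by (intro correspondence_distortion_leI) (auto simp: abs_minus_commute)

lemma correspondence_distortion_le_relcomp:
  assumes R: "correspondence_distortion_le M d N e R b"
    and S: "correspondence_distortion_le N e P f S c"
  shows "correspondence_distortion_le M d P f (R O S) (b + c)"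
proof -
  note RD = correspondence_distortion_leD[OF R] and SD = correspondence_distortion_leD[OF S]
  have "R O S \<subseteq> M \<times> P"
    using RD(1) SD(2) by blast
  moreover have "\<exists>z. (x, z) \<in> R O S" if "x \<in> M" for x
    using RD(2,3) SD(3) that by blast
  moreover have "\<exists>x. (x, z) \<in> R O S" if "z \<in> P" for z
    using RD(4) SD(1,4) that by blast
  moreover have "\<bar>d x x' - f z z'\<bar> \<le> b + c" if xz: "(x, z) \<in> R O S" "(x', z') \<in> R O S" for x x' z z'
  proof -
    obtain y y' where "(x, y) \<in> R" "(y, z) \<in> S" "(x', y') \<in> R" "(y', z') \<in> S"
      using xz by blast
    then show ?thesis using RD(5)[of x y x' y'] SD(5)[of y z y' z'] by linarith
  qed
  ultimately show ?thesis
    by (rule correspondence_distortion_leI)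
qed

lemma GH_dist_self:
  assumes "Metric_space M d" "M \<noteq> {}"
  shows "GH_dist M d M d = 0"
proof -
  have "GH_dist M d M d \<le> 0 + ennreal s" if "0 < s" for s
  proof -
    have "correspondence_distortion_le M d M d (Id_on M) (2 * s)"
      using that by (force simp: correspondence_distortion_le_def)
    then show ?thesis
      using GH_dist_le_if_correspondence[OF assms(1,1,2) that] by simp
  qed
  then show ?thesis
    by (metis ennreal_le_epsilon le_zero_eq)
qed

lemma GH_dist_commute_le:
  assumes "Metric_space M d" "Metric_space N e" "M \<noteq> {}" "N \<noteq> {}"
  shows "GH_dist M d N e \<le> GH_dist N e M d"
proof (rule ennreal_le_epsilon)
  fix \<epsilon> :: real assume fin: "GH_dist N e M d < top" and "0 < \<epsilon>"
  define a where "a = enn2real (GH_dist N e M d)"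
  have a: "GH_dist N e M d = ennreal a" and "0 \<le> a"
    using fin by (auto simp: a_def)
  have "GH_dist N e M d < ennreal (a + \<epsilon>)"
    unfolding a using \<open>0 < \<epsilon>\<close> \<open>0 \<le> a\<close> by (simp add: ennreal_less_iff)
  then have "GH_dist M d N e < ennreal (a + \<epsilon>)"
    using correspondence_distortion_le_converse
    unfolding GH_dist_less_iff[OF assms(2,1,4)] GH_dist_less_iff[OF assms(1,2,3)] by blast
  then show "GH_dist M d N e \<le> GH_dist N e M d + ennreal \<epsilon>"
    unfolding a using \<open>0 < \<epsilon>\<close> \<open>0 \<le> a\<close> by simp
qed

lemma GH_dist_commute:
  assumes "Metric_space M d" "Metric_space N e" "M \<noteq> {}" "N \<noteq> {}"
  shows "GH_dist M d N e = GH_dist N e M d"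
  using assms by (intro antisym GH_dist_commute_le)

lemma GH_dist_triangle:
  assumes M: "Metric_space M d" "M \<noteq> {}" and N: "Metric_space N e" "N \<noteq> {}"
    and P: "Metric_space P f"
  shows "GH_dist M d P f \<le> GH_dist M d N e + GH_dist N e P f"
proof (rule ennreal_le_epsilon)
  fix \<epsilon> :: real
  assume fin: "GH_dist M d N e + GH_dist N e P f < top" and "0 < \<epsilon>"
  define a where "a = enn2real (GH_dist M d N e)"
  define b where "b = enn2real (GH_dist N e P f)"
  have a: "GH_dist M d N e = ennreal a" and b: "GH_dist N e P f = ennreal b"
    and "0 \<le> a" "0 \<le> b"
    using fin by (simp_all add: a_def b_def)
  have "GH_dist M d N e < ennreal (a + \<epsilon> / 2)" "GH_dist N e P f < ennreal (b + \<epsilon> / 2)"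
    unfolding a b using \<open>0 < \<epsilon>\<close> \<open>0 \<le> a\<close> \<open>0 \<le> b\<close> by (auto simp: ennreal_less_iff)
  then obtain s R t S where st: "0 < s" "s < a + \<epsilon> / 2" "0 < t" "t < b + \<epsilon> / 2"
    and R: "correspondence_distortion_le M d N e R (2 * s)"
    and S: "correspondence_distortion_le N e P f S (2 * t)"
    by (elim correspondence_if_GH_dist_less)
  have "correspondence_distortion_le M d P f (R O S) (2 * (s + t))"
    using correspondence_distortion_le_relcomp[OF R S] by (simp add: distrib_left)
  then have "GH_dist M d P f \<le> ennreal (s + t)"
    using st by (intro GH_dist_le_if_correspondence[OF M(1) P M(2)]) auto
  also have "\<dots> \<le> ennreal (a + b + \<epsilon>)"
    using st by (intro ennreal_leI) auto
  also have "\<dots> = GH_dist M d N e + GH_dist N e P f + ennreal \<epsilon>"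
    unfolding a b using \<open>0 \<le> a\<close> \<open>0 \<le> b\<close> \<open>0 < \<epsilon>\<close> by simp
  finally show "GH_dist M d P f \<le> GH_dist M d N e + GH_dist N e P f + ennreal \<epsilon>" .
qed

section \<open>The four spaces of metrics carry analytic pseudometrics\<close>

lemma Metric_space_curry: "f \<in> metrics \<Longrightarrow> Metric_space UNIV (curry f)"
  by (simp add: metrics_def)

lemma measurable_coordinate:
  "(\<lambda>f::'i \<Rightarrow> 'b::topological_space. f i) \<in> borel_measurable borel"
  by (intro borel_measurable_continuous_onI continuous_on_product_coordinates)

lemmas sets_Collect_coordinates =
  sets.sets_Collect borel_measurable_le borel_measurable_eq borel_measurable_add
  measurable_const measurable_coordinate

lemma metrics_borel: "metrics \<in> sets borel"
proof -
  have "metrics = {f \<in> space borel. (\<forall>x y. 0 \<le> f (x, y)) \<and> (\<forall>x y. f (x, y) = f (y, x)) \<and>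
      (\<forall>x y. (f (x, y) = 0 \<longrightarrow> x = y) \<and> (x = y \<longrightarrow> f (x, y) = 0)) \<and>
      (\<forall>x y z. f (x, z) \<le> f (x, y) + f (y, z))}"
    unfolding metrics_def Metric_space_def by auto
  also have "\<dots> \<in> sets borel"
    by (intro sets_Collect_coordinates) simp_all
  finally show ?thesis .
qed

lemma metrics_ge_borel: "metrics_ge p \<in> sets borel"
proof -
  have "metrics_ge p = metrics \<inter> {f \<in> space borel. \<forall>z. f z = 0 \<or> p \<le> f z}"
    unfolding metrics_ge_def image_subset_iff Un_iff singleton_iff atLeast_iff by auto
  also have "\<dots> \<in> sets borel"
    by (intro sets.Int metrics_borel sets_Collect_coordinates) simp_all
  finally show ?thesis .
qed

lemma metrics_le_borel: "metrics_le q \<in> sets borel"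
proof -
  have "metrics_le q = metrics \<inter> {f \<in> space borel. \<forall>z. 0 \<le> f z \<and> f z \<le> q}"
    unfolding metrics_le_def image_subset_iff atLeastAtMost_iff by auto
  also have "\<dots> \<in> sets borel"
    by (intro sets.Int metrics_borel sets_Collect_coordinates) simp_all
  finally show ?thesis .
qed

lemma metrics_between_borel: "metrics_between p q \<in> sets borel"
proof -
  have "metrics_between p q =
      metrics \<inter> {f \<in> space borel. \<forall>z. f z = 0 \<or> p \<le> f z \<and> f z \<le> q}"
    unfolding metrics_between_def image_subset_iff Un_iff singleton_iff atLeastAtMost_iff by auto
  also have "\<dots> \<in> sets borel"
    by (intro sets.Int metrics_borel sets_Collect_coordinates) simp_all
  finally show ?thesis .
qed

lemma \<rho>_GH_less_iff:
  assumes "f \<in> metrics" "g \<in> metrics"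
  shows "\<rho>_GH f g < ennreal r \<longleftrightarrow>
    (\<exists>s R. 0 < s \<and> s < r \<and> correspondence_distortion_le UNIV (curry f) UNIV (curry g) R (2 * s))"
  unfolding \<rho>_GH_def
  by (rule GH_dist_less_iff[OF Metric_space_curry[OF assms(1)] Metric_space_curry[OF assms(2)] UNIV_not_empty])

text \<open>The sequence \<open>z\<close> lists codes of pairs. The values of \<open>z\<close> are compared with fixed numbers,
  instead of being substituted into \<open>f\<close> and \<open>g\<close>, so that the condition is visibly a countable
  Boolean combination of conditions on single coordinates.\<close>

definition enumerates_correspondence ::
  "(nat \<times> nat \<Rightarrow> real) \<Rightarrow> (nat \<times> nat \<Rightarrow> real) \<Rightarrow> real \<Rightarrow> (nat \<Rightarrow> nat) \<Rightarrow> bool" where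
  "enumerates_correspondence f g c z \<longleftrightarrow>
     (\<forall>n. \<exists>m k. z k = prod_encode (n, m)) \<and> (\<forall>m. \<exists>n k. z k = prod_encode (n, m)) \<and>
     (\<forall>n m n' m' k k'. z k = prod_encode (n, m) \<longrightarrow> z k' = prod_encode (n', m') \<longrightarrow>
        \<bar>f (n, n') - g (m, m')\<bar> \<le> c)"

lemma ex_correspondence_iff_ex_enumeration:
  "(\<exists>R. correspondence_distortion_le UNIV (curry f) UNIV (curry g) R c) \<longleftrightarrow>
   (\<exists>z. enumerates_correspondence f g c z)"
proof (intro iffI; elim exE)
  fix R :: "(nat \<times> nat) set"
  assume R: "correspondence_distortion_le UNIV (curry f) UNIV (curry g) R c"
  note RD = correspondence_distortion_leD[OF R]
  define e where "e = from_nat_into R"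
  have "R \<noteq> {}" using RD(3) by blast
  then have range: "range e = R"
    unfolding e_def by simp
  have z: "(\<exists>k. prod_encode (e k) = prod_encode (n, m)) \<longleftrightarrow> (n, m) \<in> R" for n m
    unfolding range[symmetric] image_iff by (auto intro: sym)
  have "enumerates_correspondence f g c (\<lambda>k. prod_encode (e k))"
    unfolding enumerates_correspondence_def
  proof (intro conjI allI impI)
    show "\<exists>m k. prod_encode (e k) = prod_encode (n, m)" for n
      unfolding z using RD(3) by blast
    show "\<exists>n k. prod_encode (e k) = prod_encode (n, m)" for m
      unfolding z using RD(4) by blast
    fix n m n' m' k k'
    assume "prod_encode (e k) = prod_encode (n, m)" "prod_encode (e k') = prod_encode (n', m')"
    then have "(n, m) \<in> R" "(n', m') \<in> R"
      using z by blast+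
    then show "\<bar>f (n, n') - g (m, m')\<bar> \<le> c"
      using RD(5) by fastforce
  qed
  then show "\<exists>z. enumerates_correspondence f g c z"
    by blast
next
  fix z assume z: "enumerates_correspondence f g c z"
  have "correspondence_distortion_le UNIV (curry f) UNIV (curry g)
      {(n, m). \<exists>k. z k = prod_encode (n, m)} c"
    using z unfolding enumerates_correspondence_def
    by (intro correspondence_distortion_leI) auto
  then show "\<exists>R. correspondence_distortion_le UNIV (curry f) UNIV (curry g) R c"
    by blast
qed

lemma correspondence_distortion_le_mono:
  assumes R: "correspondence_distortion_le M d N e R b" and "b \<le> c"
  shows "correspondence_distortion_le M d N e R c"
proof (rule correspondence_distortion_leI)
  show "\<bar>d x x' - e y y'\<bar> \<le> c" if "(x, y) \<in> R" "(x', y') \<in> R" for x y x' y'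
    using correspondence_distortion_leD(5)[OF R that] \<open>b \<le> c\<close> by simp
qed (use correspondence_distortion_leD(1-4)[OF R] in auto)

text \<open>The witness for closeness is a rational bound together with an enumerated correspondence; for
  fixed bound this is a Borel condition, and the enumeration is projected away.\<close>

lemma analytic_set_\<rho>_GH_less:
  assumes X: "X \<in> sets borel" and "X \<subseteq> metrics"
  shows "analytic_set {(f, g) \<in> X \<times> X. \<rho>_GH f g < ennreal r}"
proof -
  define B :: "(((nat \<times> nat \<Rightarrow> real) \<times> (nat \<times> nat \<Rightarrow> real)) \<times> (nat \<Rightarrow> nat)) set" where
    "B = {w \<in> space borel. fst (fst w) \<in> X \<and> snd (fst w) \<in> X \<and>
      (\<exists>t::rat. 0 < real_of_rat t \<and> real_of_rat t < r \<and>
        enumerates_correspondence (fst (fst w)) (snd (fst w)) (2 * real_of_rat t) (snd w))}"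
  have cont: "continuous_on UNIV (\<lambda>w::((nat \<times> nat \<Rightarrow> real) \<times> (nat \<times> nat \<Rightarrow> real)) \<times> (nat \<Rightarrow> nat). fst (fst w))"
    "continuous_on UNIV (\<lambda>w::((nat \<times> nat \<Rightarrow> real) \<times> (nat \<times> nat \<Rightarrow> real)) \<times> (nat \<Rightarrow> nat). snd (fst w))"
    "continuous_on UNIV (\<lambda>w::((nat \<times> nat \<Rightarrow> real) \<times> (nat \<times> nat \<Rightarrow> real)) \<times> (nat \<Rightarrow> nat). snd w)"
    by (rule continuous_on_fst continuous_on_snd continuous_on_id)+
  note meas = cont[THEN borel_measurable_continuous_onI]
  have "B \<in> sets borel"
    unfolding B_def enumerates_correspondence_def
    by (intro sets_Collect_coordinates borel_measurable_abs borel_measurable_diff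
        measurable_sets_Collect[OF meas(1), where P = "\<lambda>f. f \<in> X"]
        measurable_sets_Collect[OF meas(2), where P = "\<lambda>f. f \<in> X"]
        measurable_compose[OF meas(1) measurable_coordinate]
        measurable_compose[OF meas(2) measurable_coordinate]
        measurable_compose[OF meas(3) measurable_coordinate]) (simp_all add: X)
  moreover have "{(f, g) \<in> X \<times> X. \<rho>_GH f g < ennreal r} = fst ` B"
  proof -
    have "\<rho>_GH f g < ennreal r \<longleftrightarrow> (\<exists>z. ((f, g), z) \<in> B)" if fg: "f \<in> X" "g \<in> X" for f g
    proof -
      have fg': "f \<in> metrics" "g \<in> metrics"
        using fg \<open>X \<subseteq> metrics\<close> by auto
      have "\<rho>_GH f g < ennreal r \<longleftrightarrow> (\<exists>t::rat. 0 < real_of_rat t \<and> real_of_rat t < r \<and>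
        (\<exists>R. correspondence_distortion_le UNIV (curry f) UNIV (curry g) R (2 * real_of_rat t)))"
        (is "?L \<longleftrightarrow> ?R")
      proof
        assume ?L
        then obtain s R where s: "0 < s" "s < r"
          and R: "correspondence_distortion_le UNIV (curry f) UNIV (curry g) R (2 * s)"
          unfolding \<rho>_GH_less_iff[OF fg'] by blast
        obtain t where "s < real_of_rat t" "real_of_rat t < r"
          using of_rat_dense[OF s(2)] by blast
        moreover from this(1)
        have "correspondence_distortion_le UNIV (curry f) UNIV (curry g) R (2 * real_of_rat t)"
          using R by (elim correspondence_distortion_le_mono) simp
        ultimately show ?R using s(1) by (meson less_trans)
      next
        assume ?R
        then show ?L
          unfolding \<rho>_GH_less_iff[OF fg'] by blast
      qed
      then show ?thesis
        unfolding ex_correspondence_iff_ex_enumeration B_def using fg by auto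
    qed
    moreover have "f \<in> X" "g \<in> X" if "((f, g), z) \<in> B" for f g z
      using that by (auto simp: B_def)
    ultimately show ?thesis
      by (force simp: image_iff)
  qed
  ultimately show ?thesis
    unfolding analytic_set_def by blast
qed

lemma analytic_pseudometric_\<rho>_GH:
  assumes "X \<in> sets borel" and X: "X \<subseteq> metrics"
  shows "analytic_pseudometric X \<rho>_GH"
  unfolding analytic_pseudometric_def
proof (intro conjI ballI allI impI)
  fix f g h assume "f \<in> X" "g \<in> X" "h \<in> X"
  then show "\<rho>_GH f h \<le> \<rho>_GH f g + \<rho>_GH g h"
    unfolding \<rho>_GH_def using X by (intro GH_dist_triangle Metric_space_curry) auto
next
  fix f g assume "f \<in> X" "g \<in> X"
  then show "\<rho>_GH f g = \<rho>_GH g f"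
    unfolding \<rho>_GH_def using X by (intro GH_dist_commute Metric_space_curry) auto
next
  fix f assume "f \<in> X"
  then show "\<rho>_GH f f = 0"
    unfolding \<rho>_GH_def using X by (intro GH_dist_self Metric_space_curry) auto
qed (use assms analytic_set_\<rho>_GH_less in auto)

section \<open>Slicing a nonnegative real into bounded layers\<close>

definition slice :: "nat \<Rightarrow> real \<Rightarrow> real" where
  "slice i t = max 0 (min 1 (t - real i))"

lemma slice_bounds: "0 \<le> slice i t" "slice i t \<le> 1"
  by (auto simp: slice_def)

lemma slice_nonexpansive: "\<bar>slice i s - slice i t\<bar> \<le> \<bar>s - t\<bar>"
  by (auto simp: slice_def max_def min_def abs_if)

text \<open>The \<open>n\<close>-th slice with \<open>n = \<lfloor>t\<rfloor>\<close> measures \<open>t\<close> exactly and never exceeds \<open>s - n\<close> at \<open>s\<close>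
  unless \<open>s < n\<close>. In that case \<open>t\<close> exceeds \<open>n\<close> by at most \<open>c\<close>, and the preceding slice, which is full at \<open>t\<close>,
  shows that \<open>s\<close> falls short of \<open>n\<close> by at most \<open>c\<close>.\<close>

lemma le_add_if_slices_close:
  assumes "0 \<le> s" "0 \<le> t" and c: "c < 1/2" and close: "\<And>i. \<bar>slice i s - slice i t\<bar> \<le> c"
  shows "t \<le> s + 2 * c"
proof -
  define n where "n = nat \<lfloor>t\<rfloor>"
  have n: "real n \<le> t" "t < real n + 1"
    using \<open>0 \<le> t\<close> unfolding n_def by linarith+
  have "0 \<le> c" using close[of 0] by linarith
  show ?thesis
  proof (cases "s < real n")
    case False
    then show ?thesis
      using close[of n] n c \<open>0 \<le> c\<close> by (auto simp: slice_def max_def min_def abs_if split: if_splits)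
  next
    case True
    then have tn: "t - real n \<le> c"
      using close[of n] n by (auto simp: slice_def max_def min_def abs_if split: if_splits)
    show ?thesis
    proof (cases n)
      case 0
      then show ?thesis using True \<open>0 \<le> s\<close> by simp
    next
      case (Suc m)
      then show ?thesis
        using close[of m] n c tn True
        by (auto simp: slice_def max_def min_def abs_if split: if_splits)
    qed
  qed
qed

lemma abs_diff_le_if_slices_close:
  assumes "0 \<le> s" "0 \<le> t" "c < 1/2" "\<And>i. \<bar>slice i s - slice i t\<bar> \<le> c"
  shows "\<bar>s - t\<bar> \<le> 2 * c"
proof -
  have "t \<le> s + 2 * c"
    using assms by (rule le_add_if_slices_close)
  moreover have "s \<le> t + 2 * c"
    using assms by (intro le_add_if_slices_close) (simp_all add: abs_minus_commute)
  ultimately show ?thesis by linarith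
qed

section \<open>Ladders\<close>

fun rung_adjacent :: "'a \<times> nat \<Rightarrow> 'a \<times> nat \<Rightarrow> bool" where
  "rung_adjacent (x, i) (y, j) \<longleftrightarrow> x = y \<and> (j = Suc i \<or> i = Suc j)"

text \<open>The adjacency graph is a disjoint union of one-way infinite paths. The end points of the paths
  are recognised by having a single neighbour, and from there the height of a point is its distance
  to the end point of its path.\<close>

lemma rung_adjacent_automorphism:
  fixes \<sigma> :: "'a \<times> nat \<Rightarrow> 'b \<times> nat"
  assumes "bij \<sigma>" and adj: "\<And>u v. rung_adjacent (\<sigma> u) (\<sigma> v) \<longleftrightarrow> rung_adjacent u v"
  obtains \<tau> where "bij \<tau>" "\<And>x i. \<sigma> (x, i) = (\<tau> x, i)"
proof -
  have inj: "\<sigma> u = \<sigma> v \<longleftrightarrow> u = v" for u v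
    using bij_is_inj[OF \<open>bij \<sigma>\<close>] by (simp add: inj_eq)
  have surj: "\<exists>u. \<sigma> u = w" for w
    using bij_is_surj[OF \<open>bij \<sigma>\<close>] unfolding surj_def by metis
  \<comment> \<open>A point of positive height has two neighbours, but \<^term>\<open>(x, 0)\<close> has only one.\<close>
  have bottom: "snd (\<sigma> (x, 0)) = 0" for x
  proof (rule ccontr)
    assume "snd (\<sigma> (x, 0)) \<noteq> 0"
    then obtain y i where y: "\<sigma> (x, 0) = (y, Suc i)"
      by (cases "\<sigma> (x, 0)") (auto simp: gr0_conv_Suc)
    obtain u where u: "\<sigma> u = (y, i)" using surj by blast
    obtain v where v: "\<sigma> v = (y, Suc (Suc i))" using surj by blast
    have "rung_adjacent (x, 0) u" "rung_adjacent (x, 0) v"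
      unfolding adj[symmetric] u v y by simp_all
    then have "u = v"
      by (cases u; cases v) simp
    then show False using u v by simp
  qed
  define \<tau> where "\<tau> x = fst (\<sigma> (x, 0))" for x
  have \<sigma>: "\<sigma> (x, i) = (\<tau> x, i)" for x i
  proof (induction i rule: less_induct)
    case (less i)
    consider "i = 0" | "i = Suc 0" | j where "i = Suc (Suc j)"
      by (cases i rule: nat.exhaust[case_names Z S]; cases "i - 1") auto
    then show ?case
    proof cases
      case 1
      then show ?thesis using bottom[of x] by (simp add: \<tau>_def prod_eq_iff)
    next
      case 2
      then have "\<sigma> (x, 0) = (\<tau> x, 0)"
        using less.IH by simp
      moreover have "rung_adjacent (\<sigma> (x, 0)) (\<sigma> (x, i))"
        unfolding adj using 2 by simp
      ultimately show ?thesis using 2 by (cases "\<sigma> (x, i)") auto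
    next
      case 3
      then have "\<sigma> (x, Suc j) = (\<tau> x, Suc j)" "\<sigma> (x, j) = (\<tau> x, j)"
        using less.IH by auto
      moreover have "rung_adjacent (\<sigma> (x, Suc j)) (\<sigma> (x, i))"
        unfolding adj using 3 by simp
      moreover have "\<sigma> (x, i) \<noteq> \<sigma> (x, j)"
        unfolding inj using 3 by simp
      ultimately show ?thesis using 3 by (cases "\<sigma> (x, i)") auto
    qed
  qed
  have "inj \<tau>"
  proof (rule injI)
    fix x y assume "\<tau> x = \<tau> y"
    then have "\<sigma> (x, 0) = \<sigma> (y, 0)" by (simp add: \<sigma>)
    then show "x = y" by (simp only: inj prod.inject)
  qed
  moreover have "\<exists>x. y = \<tau> x" for y
  proof -
    obtain u where "\<sigma> u = (y, 0)" using surj by blast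
    then show ?thesis by (cases u) (auto simp: \<sigma>)
  qed
  then have "surj \<tau>" by (simp add: surj_def)
  ultimately have "bij \<tau>" by (simp add: bij_def)
  then show ?thesis using \<sigma> by (rule that)
qed

fun ladder_dist :: "real \<Rightarrow> real \<Rightarrow> ('a \<Rightarrow> 'a \<Rightarrow> real) \<Rightarrow> 'a \<times> nat \<Rightarrow> 'a \<times> nat \<Rightarrow> real" where
  "ladder_dist p h F (x, i) (y, j) =
     (if (x, i) = (y, j) then 0
      else if rung_adjacent (x, i) (y, j) then p + h
      else if i = j then p + h / 2 * slice i (F x y)
      else p)"

lemma ladder_dist_self: "ladder_dist p h F u u = 0"
  by (cases u) simp

lemma ladder_dist_adjacent: "rung_adjacent u v \<Longrightarrow> ladder_dist p h F u v = p + h"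
  by (cases u; cases v) auto

lemma ladder_dist_bounds:
  assumes "0 < h" "u \<noteq> v"
  shows "p \<le> ladder_dist p h F u v" "ladder_dist p h F u v \<le> p + h"
    and "\<not> rung_adjacent u v \<Longrightarrow> ladder_dist p h F u v \<le> p + h / 2"
proof -
  obtain x i y j where uv: "u = (x, i)" "v = (y, j)" by (cases u; cases v)
  have "0 \<le> h / 2 * slice i (F x y)"
    using \<open>0 < h\<close> slice_bounds(1) by simp
  moreover have "h / 2 * slice i (F x y) \<le> h / 2"
    using \<open>0 < h\<close> slice_bounds(2) by (intro mult_left_le) simp_all
  ultimately show "p \<le> ladder_dist p h F u v" "ladder_dist p h F u v \<le> p + h"
    "\<not> rung_adjacent u v \<Longrightarrow> ladder_dist p h F u v \<le> p + h / 2"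
    using assms unfolding uv ladder_dist.simps by (auto simp del: rung_adjacent.simps)
qed

text \<open>Nonzero distances lie in \<open>[p, p + h]\<close> and \<open>p + h \<le> 2 * p\<close>, so the triangle inequality is
  automatic, whatever \<open>F\<close> is.\<close>

lemma Metric_space_ladder_dist:
  assumes "0 < h" "h \<le> p" and F: "\<And>x y. F x y = F y x"
  shows "Metric_space UNIV (ladder_dist p h F)"
proof
  have pos: "0 < ladder_dist p h F u v" if "u \<noteq> v" for u v
    using ladder_dist_bounds(1)[OF \<open>0 < h\<close> that, of p F] assms by linarith
  show nonneg: "0 \<le> ladder_dist p h F u v" for u v
    using pos[of u v] by (cases "u = v") (auto simp: ladder_dist_self)
  show "ladder_dist p h F u v = 0 \<longleftrightarrow> u = v" for u v
    using pos[of u v] by (cases "u = v") (auto simp: ladder_dist_self)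
  show "ladder_dist p h F u v = ladder_dist p h F v u" for u v
    using F by (cases u; cases v) auto
  show "ladder_dist p h F u w \<le> ladder_dist p h F u v + ladder_dist p h F v w" for u v w
  proof (cases "u = v \<or> v = w \<or> u = w")
    case True
    then show ?thesis
      using nonneg[of u v] nonneg[of v u] by (auto simp: ladder_dist_self simp del: ladder_dist.simps)
  next
    case False
    then show ?thesis
      using ladder_dist_bounds[OF \<open>0 < h\<close>, of u v p F] ladder_dist_bounds[OF \<open>0 < h\<close>, of v w p F]
        ladder_dist_bounds[OF \<open>0 < h\<close>, of u w p F] \<open>h \<le> p\<close> by linarith
  qed
qed

section \<open>Correspondences and bijections\<close>

text \<open>All fibres are countably infinite, so each can be numbered by the natural numbers.\<close>

lemma bij_onto_product_with_nat:
  fixes \<pi> :: "'c \<Rightarrow> 'a"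
  assumes "countable S" and inf: "\<And>x. infinite {s \<in> S. \<pi> s = x}"
  obtains \<theta> where "bij_betw \<theta> S (UNIV :: ('a \<times> nat) set)" "\<And>s. fst (\<theta> s) = \<pi> s"
proof
  define \<theta> where "\<theta> s = (\<pi> s, to_nat_on {s' \<in> S. \<pi> s' = \<pi> s} s)" for s
  have count: "countable {s \<in> S. \<pi> s = x}" for x
    using \<open>countable S\<close> by (rule countable_subset[rotated]) auto
  show "bij_betw \<theta> S UNIV"
  proof (rule bij_betw_imageI)
    show "inj_on \<theta> S"
      using count by (auto simp: \<theta>_def inj_on_def)
    have "\<exists>s\<in>S. \<theta> s = (x, n)" for x n
      using to_nat_on_surj[OF count inf, of x n] by (auto simp: \<theta>_def)
    then show "\<theta> ` S = UNIV" by (auto simp: image_iff) metis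
  qed
  show "fst (\<theta> s) = \<pi> s" for s by (simp add: \<theta>_def)
qed

text \<open>Infinitely many copies of \<open>R\<close> have infinite fibres over both factors. Hence they are fibrewise
  in bijection with infinitely many copies of either factor, and the two bijections are composed.\<close>

lemma bij_along_correspondence:
  fixes R :: "('a::countable \<times> 'b::countable) set"
  assumes "\<And>x. \<exists>y. (x, y) \<in> R" and "\<And>y. \<exists>x. (x, y) \<in> R"
  obtains \<tau> :: "'a \<times> nat \<Rightarrow> 'b \<times> nat" where "bij \<tau>" "\<And>u. (fst u, fst (\<tau> u)) \<in> R"
proof -
  define S where "S = R \<times> (UNIV :: nat set)"
  have "countable S" by simp
  have inf1: "infinite {s \<in> S. fst (fst s) = x}" for x
  proof -
    obtain y where "(x, y) \<in> R" using assms(1) by blast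
    then have "range (Pair (x, y)) \<subseteq> {s \<in> S. fst (fst s) = x}" by (auto simp: S_def)
    moreover have "infinite (range (Pair (x, y) :: nat \<Rightarrow> _))"
      by (intro range_inj_infinite) (simp add: inj_def)
    ultimately show ?thesis by (rule infinite_super)
  qed
  have inf2: "infinite {s \<in> S. snd (fst s) = y}" for y
  proof -
    obtain x where "(x, y) \<in> R" using assms(2) by blast
    then have "range (Pair (x, y)) \<subseteq> {s \<in> S. snd (fst s) = y}" by (auto simp: S_def)
    moreover have "infinite (range (Pair (x, y) :: nat \<Rightarrow> _))"
      by (intro range_inj_infinite) (simp add: inj_def)
    ultimately show ?thesis by (rule infinite_super)
  qed
  obtain \<alpha> where \<alpha>: "bij_betw \<alpha> S (UNIV :: ('a \<times> nat) set)" "\<And>s. fst (\<alpha> s) = fst (fst s)"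
    using bij_onto_product_with_nat[OF \<open>countable S\<close> inf1] by metis
  obtain \<beta> where \<beta>: "bij_betw \<beta> S (UNIV :: ('b \<times> nat) set)" "\<And>s. fst (\<beta> s) = snd (fst s)"
    using bij_onto_product_with_nat[OF \<open>countable S\<close> inf2] by metis
  define \<tau> where "\<tau> = \<beta> \<circ> inv_into S \<alpha>"
  have "bij \<tau>"
    unfolding \<tau>_def using bij_betw_trans[OF bij_betw_inv_into[OF \<alpha>(1)] \<beta>(1)] .
  moreover have "(fst u, fst (\<tau> u)) \<in> R" for u
  proof -
    define s where "s = inv_into S \<alpha> u"
    have "s \<in> S" "\<alpha> s = u"
      using \<alpha>(1) by (auto simp: s_def bij_betw_def inv_into_into f_inv_into_f)
    moreover have "\<tau> u = \<beta> s"
      by (simp add: \<tau>_def s_def)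
    ultimately show ?thesis
      using \<alpha>(2)[of s] \<beta>(2)[of s] by (auto simp: S_def)
  qed
  ultimately show ?thesis by (rule that)
qed

text \<open>Two points related to the same point have distance at most \<open>c < p\<close>, hence coincide.\<close>

lemma separated_correspondence_bij:
  assumes R: "correspondence_distortion_le UNIV d UNIV e R c" and "c < p"
    and d: "\<And>x x'. x \<noteq> x' \<Longrightarrow> p \<le> d x x'" "\<And>x. d x x = 0"
    and e: "\<And>y y'. y \<noteq> y' \<Longrightarrow> p \<le> e y y'" "\<And>y. e y y = 0"
  obtains \<sigma> where "bij \<sigma>" "\<And>x x'. \<bar>d x x' - e (\<sigma> x) (\<sigma> x')\<bar> \<le> c"
proof -
  note RD = correspondence_distortion_leD[OF R]
  have "\<forall>x. \<exists>y. (x, y) \<in> R"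
    using RD(3) by simp
  then obtain \<sigma> where \<sigma>: "\<And>x. (x, \<sigma> x) \<in> R"
    unfolding choice_iff by blast
  have close: "\<bar>d x x' - e (\<sigma> x) (\<sigma> x')\<bar> \<le> c" for x x'
    by (rule RD(5)[OF \<sigma> \<sigma>])
  have "inj \<sigma>"
  proof (rule injI)
    fix x x' assume "\<sigma> x = \<sigma> x'"
    then have "d x x' \<le> c" using close[of x x'] e(2) by simp
    then show "x = x'" using d(1)[of x x'] \<open>c < p\<close> by linarith
  qed
  moreover have "\<exists>x. y = \<sigma> x" for y
  proof -
    obtain x where x: "(x, y) \<in> R" using RD(4)[of y] by blast
    have "e y (\<sigma> x) \<le> c" using RD(5)[OF x \<sigma>[of x]] d(2)[of x] by simp
    then have "y = \<sigma> x" using e(1)[of y "\<sigma> x"] \<open>c < p\<close> by linarith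
    then show ?thesis ..
  qed
  ultimately have "bij \<sigma>" by (simp add: bij_def surj_def)
  then show ?thesis using close by (rule that)
qed

section \<open>Ladders over close functions, and back\<close>

lemma rung_adjacent_map_prod:
  assumes "inj \<tau>"
  shows "rung_adjacent (map_prod \<tau> id u) (map_prod \<tau> id v) \<longleftrightarrow> rung_adjacent u v"
  using assms by (cases u; cases v) (simp add: inj_eq)

lemma abs_diff_mult_left: "0 \<le> a \<Longrightarrow> \<bar>a * s - a * t\<bar> = a * \<bar>s - t\<bar>" for a :: real
  by (simp add: abs_mult flip: right_diff_distrib)

lemma ladder_dist_close:
  assumes "inj \<tau>" "0 < h" and close: "\<And>x y. \<bar>F x y - G (\<tau> x) (\<tau> y)\<bar> \<le> c"
  shows "\<bar>ladder_dist p h F u v - ladder_dist p h G (map_prod \<tau> id u) (map_prod \<tau> id v)\<bar> \<le> h / 2 * c"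
proof -
  obtain x i y j where uv: "u = (x, i)" "v = (y, j)" by (cases u; cases v)
  define k where "k = h / 2"
  have "0 \<le> c" using close[of x y] by linarith
  have "0 \<le> k" using \<open>0 < h\<close> by (simp add: k_def)
  have "\<bar>slice i (F x y) - slice i (G (\<tau> x) (\<tau> y))\<bar> \<le> c"
    by (rule order_trans[OF slice_nonexpansive close])
  then have "\<bar>k * slice i (F x y) - k * slice i (G (\<tau> x) (\<tau> y))\<bar> \<le> k * c"
    unfolding abs_diff_mult_left[OF \<open>0 \<le> k\<close>] using \<open>0 \<le> k\<close> by (rule mult_left_mono)
  moreover have "0 \<le> k * c" using \<open>0 \<le> c\<close> \<open>0 \<le> k\<close> by simp
  ultimately show ?thesis
    using inj_eq[OF \<open>inj \<tau>\<close>] unfolding uv map_prod_simp ladder_dist.simps k_def[symmetric] by auto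
qed

text \<open>No distance lies strictly between \<open>p + h / 2\<close> and \<open>p + h\<close>; this gap separates adjacent points from
  all others.\<close>

lemma ladder_dist_gt_iff:
  assumes "0 < h" "0 < p" "p + h / 2 \<le> t" "t < p + h"
  shows "t < ladder_dist p h F u v \<longleftrightarrow> rung_adjacent u v"
proof (cases "u = v")
  case True
  then show ?thesis using assms by (cases u) (auto simp: ladder_dist_self)
next
  case False
  then show ?thesis
    using ladder_dist_bounds(3)[OF \<open>0 < h\<close> False, of p F] ladder_dist_adjacent[of u v p h F] assms
    by (cases "rung_adjacent u v") auto
qed

text \<open>An error below \<open>h / 4\<close> cannot bridge the gap of width \<open>h / 2\<close>, so \<open>\<sigma>\<close> preserves adjacency and
  maps ladders to ladders. As slices are scaled by \<open>h / 2\<close>, the error of each slice is at most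
  \<open>2 * c / h < 1 / 2\<close>, and recovering a real from its slices doubles it.\<close>

lemma ladder_dist_recover:
  assumes h: "0 < h" "h \<le> p" and "c < h / 4" and "bij \<sigma>"
    and F: "\<And>x y. 0 \<le> F x y" "\<And>x. F x x = 0" and G: "\<And>x y. 0 \<le> G x y" "\<And>x. G x x = 0"
    and close: "\<And>u v. \<bar>ladder_dist p h F u v - ladder_dist p h G (\<sigma> u) (\<sigma> v)\<bar> \<le> c"
  obtains \<tau> where "bij \<tau>" "\<And>x y. \<bar>F x y - G (\<tau> x) (\<tau> y)\<bar> \<le> 4 * c / h"
proof -
  have "0 \<le> c" using close[of undefined undefined] by linarith
  have "rung_adjacent (\<sigma> u) (\<sigma> v) \<longleftrightarrow> rung_adjacent u v" for u v
  proof
    assume "rung_adjacent (\<sigma> u) (\<sigma> v)"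
    then have "p + h / 2 < ladder_dist p h F u v"
      using close[of u v] ladder_dist_adjacent[of "\<sigma> u" "\<sigma> v" p h G] h \<open>c < h / 4\<close> by linarith
    then show "rung_adjacent u v"
      using ladder_dist_gt_iff[of h p "p + h / 2" F u v] h by simp
  next
    assume "rung_adjacent u v"
    then have "p + h / 2 < ladder_dist p h G (\<sigma> u) (\<sigma> v)"
      using close[of u v] ladder_dist_adjacent[of u v p h F] h \<open>c < h / 4\<close> by linarith
    then show "rung_adjacent (\<sigma> u) (\<sigma> v)"
      using ladder_dist_gt_iff[of h p "p + h / 2" G "\<sigma> u" "\<sigma> v"] h by simp
  qed
  then obtain \<tau> where "bij \<tau>" and \<tau>: "\<And>x i. \<sigma> (x, i) = (\<tau> x, i)"
    using rung_adjacent_automorphism[OF \<open>bij \<sigma>\<close>] by blast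
  have "\<bar>F x y - G (\<tau> x) (\<tau> y)\<bar> \<le> 4 * c / h" for x y
  proof (cases "x = y")
    case True
    then show ?thesis using F(2) G(2) \<open>0 \<le> c\<close> h by simp
  next
    case False
    then have "\<tau> x \<noteq> \<tau> y" using \<open>bij \<tau>\<close> by (simp add: bij_is_inj inj_eq)
    have "\<bar>slice i (F x y) - slice i (G (\<tau> x) (\<tau> y))\<bar> \<le> 2 * c / h" for i
    proof -
      have "h / 2 * \<bar>slice i (F x y) - slice i (G (\<tau> x) (\<tau> y))\<bar>
          = \<bar>h / 2 * slice i (F x y) - h / 2 * slice i (G (\<tau> x) (\<tau> y))\<bar>"
        using h by (subst abs_diff_mult_left) simp_all
      also have "\<dots> \<le> c"
        using close[of "(x, i)" "(y, i)"] False \<open>\<tau> x \<noteq> \<tau> y\<close> by (simp add: \<tau>)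
      finally show ?thesis using h by (simp add: field_simps)
    qed
    moreover have "2 * c / h < 1 / 2" using \<open>c < h / 4\<close> h by (simp add: field_simps)
    ultimately have "\<bar>F x y - G (\<tau> x) (\<tau> y)\<bar> \<le> 2 * (2 * c / h)"
      using F(1) G(1) by (intro abs_diff_le_if_slices_close)
    then show ?thesis by simp
  qed
  with \<open>bij \<tau>\<close> show ?thesis by (rule that)
qed

section \<open>The reduction\<close>

text \<open>The pair \<open>((n, k), i)\<close> is the point of height \<open>i\<close> on the ladder over the \<open>k\<close>-th copy of \<open>n\<close>. Any
  enumeration of these points serves.\<close>

definition ladder_point :: "nat \<Rightarrow> (nat \<times> nat) \<times> nat" where
  "ladder_point = from_nat_into UNIV"

lemma bij_ladder_point: "bij ladder_point"
  unfolding ladder_point_def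
  by (intro bij_betw_from_nat_into) (simp_all add: finite_prod)

definition ladder_code :: "real \<Rightarrow> real \<Rightarrow> (nat \<times> nat \<Rightarrow> real) \<Rightarrow> nat \<times> nat \<Rightarrow> real" where
  "ladder_code p h f = (\<lambda>(u, v).
     ladder_dist p h (\<lambda>x y. f (fst x, fst y)) (ladder_point u) (ladder_point v))"

lemma ladder_point_eq_iff: "ladder_point u = ladder_point v \<longleftrightarrow> u = v"
  using bij_ladder_point by (simp add: bij_is_inj inj_eq)

lemma metricsD:
  assumes "f \<in> metrics"
  shows "0 \<le> f (x, y)" "f (x, x) = 0" "f (x, y) = f (y, x)"
proof -
  interpret Metric_space UNIV "curry f" by (rule Metric_space_curry[OF assms])
  show "0 \<le> f (x, y)" "f (x, x) = 0" "f (x, y) = f (y, x)"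
    using nonneg[of x y] zero[of x x] commute[of x y] by simp_all
qed

lemma ladder_code_in_metrics_between:
  assumes "0 < h" "h \<le> p" "p + h \<le> q" and f: "f \<in> metrics"
  shows "ladder_code p h f \<in> metrics_between p q"
proof -
  let ?L = "ladder_dist p h (\<lambda>x y :: nat \<times> nat. f (fst x, fst y))"
  interpret Metric_space UNIV ?L
    using assms metricsD(3)[OF f] by (intro Metric_space_ladder_dist)
  have "Metric_space UNIV (curry (ladder_code p h f))"
    by unfold_locales
      (auto simp: ladder_code_def commute ladder_point_eq_iff triangle simp del: ladder_dist.simps)
  moreover have "ladder_code p h f (u, v) \<in> {0} \<union> {p..q}" for u v
    using ladder_dist_bounds(1,2)[OF \<open>0 < h\<close>, of "ladder_point u" "ladder_point v" p
        "\<lambda>x y. f (fst x, fst y)"] \<open>p + h \<le> q\<close>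
    by (cases "u = v") (simp_all add: ladder_code_def ladder_dist_self ladder_point_eq_iff)
  then have "range (ladder_code p h f) \<subseteq> {0} \<union> {p..q}"
    unfolding image_subset_iff by simp
  ultimately show ?thesis
    by (simp add: metrics_between_def metrics_def)
qed

lemma continuous_ladder_dist:
  "continuous_on UNIV (\<lambda>f :: 'a \<times> 'a \<Rightarrow> real. ladder_dist p h (\<lambda>x y. f (k x, k y)) u v)"
proof -
  obtain x i y j where uv: "u = (x, i)" "v = (y, j)" by (cases u; cases v)
  have "continuous_on UNIV (\<lambda>f :: 'a \<times> 'a \<Rightarrow> real. p + h / 2 * slice i (f (k x, k y)))"
    unfolding slice_def
    by (intro continuous_on_add continuous_on_mult continuous_on_max continuous_on_min
        continuous_on_diff continuous_on_const continuous_on_product_coordinates)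
  then show ?thesis
    unfolding uv ladder_dist.simps by (cases "x = y"; cases "i = j"; cases "j = Suc i \<or> i = Suc j") simp_all
qed

lemma ladder_code_measurable: "ladder_code p h \<in> borel_measurable borel"
proof (rule borel_measurable_continuous_onI, rule continuous_on_coordinatewise_then_product)
  fix z :: "nat \<times> nat"
  show "continuous_on UNIV (\<lambda>f. ladder_code p h f z)"
    using continuous_ladder_dist[of p h fst] by (cases z) (simp add: ladder_code_def)
qed

lemma correspondence_ladder_code:
  assumes "0 < h" and R: "correspondence_distortion_le UNIV (curry f) UNIV (curry g) R c"
  obtains R' where "correspondence_distortion_le UNIV (curry (ladder_code p h f))
    UNIV (curry (ladder_code p h g)) R' (h / 2 * c)"
proof -
  note RD = correspondence_distortion_leD[OF R]
  obtain \<tau> :: "nat \<times> nat \<Rightarrow> nat \<times> nat" where "bij \<tau>" and \<tau>: "\<And>u. (fst u, fst (\<tau> u)) \<in> R"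
    using bij_along_correspondence[of R] RD(3)[OF UNIV_I] RD(4)[OF UNIV_I] by blast
  have close: "\<bar>f (fst x, fst y) - g (fst (\<tau> x), fst (\<tau> y))\<bar> \<le> c" for x y
    using RD(5)[OF \<tau>[of x] \<tau>[of y]] by simp
  define R' where "R' = {(u, v). ladder_point v = map_prod \<tau> id (ladder_point u)}"
  have surj: "surj ladder_point"
    by (rule bij_is_surj[OF bij_ladder_point])
  moreover have "surj (map_prod \<tau> (id :: nat \<Rightarrow> nat))"
    using \<open>bij \<tau>\<close> by (intro map_prod_surj bij_is_surj) simp_all
  ultimately have surj': "surj (map_prod \<tau> (id :: nat \<Rightarrow> nat) \<circ> ladder_point)"
    by (rule comp_surj)
  have "correspondence_distortion_le UNIV (curry (ladder_code p h f))
    UNIV (curry (ladder_code p h g)) R' (h / 2 * c)"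
  proof (rule correspondence_distortion_leI)
    show "\<exists>v. (u, v) \<in> R'" for u
      using surjD[OF surj, of "map_prod \<tau> id (ladder_point u)"] by (auto simp: R'_def)
    show "\<exists>u. (u, v) \<in> R'" for v
      using surjD[OF surj', of "ladder_point v"] by (auto simp: R'_def)
    fix u v u' v' assume "(u, v) \<in> R'" "(u', v') \<in> R'"
    then show "\<bar>curry (ladder_code p h f) u u' - curry (ladder_code p h g) v v'\<bar> \<le> h / 2 * c"
      using ladder_dist_close[OF bij_is_inj[OF \<open>bij \<tau>\<close>] \<open>0 < h\<close>, where c = c and p = p
          and F = "\<lambda>x y. f (fst x, fst y)" and G = "\<lambda>x y. g (fst x, fst y)"
          and u = "ladder_point u" and v = "ladder_point u'"] close
      by (simp add: R'_def ladder_code_def)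
  qed simp
  then show ?thesis by (rule that)
qed

lemma correspondence_of_ladder_code:
  assumes h: "0 < h" "h \<le> p" and "c < h / 4" and f: "f \<in> metrics" and g: "g \<in> metrics"
    and R: "correspondence_distortion_le UNIV (curry (ladder_code p h f))
      UNIV (curry (ladder_code p h g)) R c"
  obtains R' where "correspondence_distortion_le UNIV (curry f) UNIV (curry g) R' (4 * c / h)"
proof -
  let ?F = "\<lambda>x y :: nat \<times> nat. f (fst x, fst y)" and ?G = "\<lambda>x y :: nat \<times> nat. g (fst x, fst y)"
  have sep: "u \<noteq> v \<Longrightarrow> p \<le> curry (ladder_code p h k) u v" "curry (ladder_code p h k) u u = 0"
    for k u v
    using ladder_dist_bounds(1)[OF h(1), of "ladder_point u" "ladder_point v" p]
    by (simp_all add: ladder_code_def ladder_dist_self ladder_point_eq_iff)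
  have "c < p" using h \<open>c < h / 4\<close> by linarith
  obtain \<sigma> where "bij \<sigma>"
    and \<sigma>: "\<And>u v. \<bar>curry (ladder_code p h f) u v - curry (ladder_code p h g) (\<sigma> u) (\<sigma> v)\<bar> \<le> c"
    using separated_correspondence_bij[OF R \<open>c < p\<close>] sep by blast
  define \<sigma>' where "\<sigma>' = ladder_point \<circ> \<sigma> \<circ> inv ladder_point"
  have "bij \<sigma>'"
    unfolding \<sigma>'_def using \<open>bij \<sigma>\<close> bij_ladder_point by (intro bij_comp bij_imp_bij_inv)
  moreover have "\<bar>ladder_dist p h ?F u v - ladder_dist p h ?G (\<sigma>' u) (\<sigma>' v)\<bar> \<le> c" for u v
    using \<sigma>[of "inv ladder_point u" "inv ladder_point v"] bij_is_surj[OF bij_ladder_point]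
    by (simp add: ladder_code_def \<sigma>'_def surj_f_inv_f)
  ultimately obtain \<tau> where "bij \<tau>" and \<tau>: "\<And>x y. \<bar>?F x y - ?G (\<tau> x) (\<tau> y)\<bar> \<le> 4 * c / h"
    using metricsD(1,2)[OF f] metricsD(1,2)[OF g]
    by (elim ladder_dist_recover[OF h \<open>c < h / 4\<close>, rotated -1]) auto
  define R' where "R' = range (\<lambda>x. (fst x, fst (\<tau> x)))"
  have "correspondence_distortion_le UNIV (curry f) UNIV (curry g) R' (4 * c / h)"
  proof (rule correspondence_distortion_leI)
    show "\<exists>m. (n, m) \<in> R'" for n
      by (auto simp: R'_def image_iff)
    show "\<exists>n. (n, m) \<in> R'" for m
    proof -
      obtain x where x: "(m, 0) = \<tau> x" using surjD[OF bij_is_surj[OF \<open>bij \<tau>\<close>]] by blast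
      have "(fst x, m) \<in> R'" unfolding R'_def by (rule image_eqI[of _ _ x]) (simp_all flip: x)
      then show ?thesis by blast
    qed
  qed (use \<tau> in \<open>auto simp: R'_def\<close>)
  then show ?thesis by (rule that)
qed

text \<open>The distance is half the infimum of the distortions. Coding multiplies distortions by at most \<open>h / 2\<close>,
  which gives \<open>\<delta>X\<close>. Decoding multiplies a distortion \<open>2 * s\<close> by \<open>4 / h\<close>, provided that \<open>2 * s < h / 4\<close>;
  these are the two terms in \<open>\<delta>Y\<close>.\<close>

lemma Borel_uc_reduction_ladder_code:
  assumes h: "0 < h" "h \<le> p" "p + h \<le> q"
  shows "Borel_uc_reduction metrics \<rho>_GH (metrics_between p q) \<rho>_GH (ladder_code p h)"
  unfolding Borel_uc_reduction_def
proof (intro conjI allI impI)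
  show "ladder_code p h \<in> restrict_space borel metrics \<rightarrow>\<^sub>M restrict_space borel (metrics_between p q)"
    using ladder_code_in_metrics_between[OF h] ladder_code_measurable
    by (intro measurable_restrict_space3) auto
  fix \<epsilon> :: real assume "0 < \<epsilon>"
  have code: "ladder_code p h f \<in> metrics" if "f \<in> metrics" for f
    using ladder_code_in_metrics_between[OF h that] by (simp add: metrics_between_def)
  have "\<rho>_GH (ladder_code p h f) (ladder_code p h g) < ennreal \<epsilon>"
    if fg: "f \<in> metrics" "g \<in> metrics" and less: "\<rho>_GH f g < ennreal (2 * \<epsilon> / h)" for f g
  proof -
    obtain s R where s: "0 < s" "s < 2 * \<epsilon> / h"
      and R: "correspondence_distortion_le UNIV (curry f) UNIV (curry g) R (2 * s)"
      using less unfolding \<rho>_GH_less_iff[OF fg] by blast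
    obtain R' where "correspondence_distortion_le UNIV (curry (ladder_code p h f))
        UNIV (curry (ladder_code p h g)) R' (2 * (h / 2 * s))"
      using correspondence_ladder_code[OF h(1) R, of p] by (auto simp: algebra_simps)
    moreover have "0 < h / 2 * s" "h / 2 * s < \<epsilon>"
      using s h by (simp_all add: field_simps)
    ultimately show ?thesis
      unfolding \<rho>_GH_less_iff[OF code[OF fg(1)] code[OF fg(2)]] by blast
  qed
  moreover have "\<rho>_GH f g < ennreal \<epsilon>"
    if fg: "f \<in> metrics" "g \<in> metrics"
      and less: "\<rho>_GH (ladder_code p h f) (ladder_code p h g) < ennreal (min (h / 8) (\<epsilon> * h / 4))"
    for f g
  proof -
    obtain s R where s: "0 < s" "s < min (h / 8) (\<epsilon> * h / 4)"
      and R: "correspondence_distortion_le UNIV (curry (ladder_code p h f))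
        UNIV (curry (ladder_code p h g)) R (2 * s)"
      using less unfolding \<rho>_GH_less_iff[OF code[OF fg(1)] code[OF fg(2)]] by blast
    have "2 * s < h / 4" using s by simp
    then obtain R' where "correspondence_distortion_le UNIV (curry f) UNIV (curry g) R' (2 * (4 * s / h))"
      using correspondence_of_ladder_code[OF h(1,2) _ fg R] by (auto simp: algebra_simps)
    moreover have "0 < 4 * s / h" "4 * s / h < \<epsilon>"
      using s h by (simp_all add: field_simps)
    ultimately show ?thesis
      unfolding \<rho>_GH_less_iff[OF fg] by blast
  qed
  ultimately show "\<exists>\<delta>X \<delta>Y. 0 < \<delta>X \<and> 0 < \<delta>Y \<and> (\<forall>f\<in>metrics. \<forall>g\<in>metrics.
      (\<rho>_GH f g < ennreal \<delta>X \<longrightarrow> \<rho>_GH (ladder_code p h f) (ladder_code p h g) < ennreal \<epsilon>) \<and>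
      (\<rho>_GH (ladder_code p h f) (ladder_code p h g) < ennreal \<delta>Y \<longrightarrow> \<rho>_GH f g < ennreal \<epsilon>))"
    using h \<open>0 < \<epsilon>\<close>
    by (intro exI[of _ "2 * \<epsilon> / h"] exI[of _ "min (h / 8) (\<epsilon> * h / 4)"]) auto
qed

lemma Borel_uc_reduction_subsets:
  assumes f: "Borel_uc_reduction X \<rho> Y \<sigma> f" and "X' \<subseteq> X" "Y \<subseteq> Y'"
  shows "Borel_uc_reduction X' \<rho> Y' \<sigma> f"
  unfolding Borel_uc_reduction_def
proof (intro conjI allI impI)
  have meas: "f \<in> restrict_space borel X \<rightarrow>\<^sub>M restrict_space borel Y"
    using f by (simp add: Borel_uc_reduction_def)
  then have "f \<in> restrict_space borel X' \<rightarrow>\<^sub>M borel"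
    using measurable_restrict_mono[OF meas \<open>X' \<subseteq> X\<close>] unfolding measurable_restrict_space2_iff by blast
  moreover have "f \<in> X' \<rightarrow> Y'"
    using measurable_space[OF meas] \<open>X' \<subseteq> X\<close> \<open>Y \<subseteq> Y'\<close> by (auto simp: space_restrict_space)
  ultimately show "f \<in> restrict_space borel X' \<rightarrow>\<^sub>M restrict_space borel Y'"
    by (intro measurable_restrict_space2) (auto simp: space_restrict_space)
  fix \<epsilon> :: real assume "0 < \<epsilon>"
  with f obtain \<delta>X \<delta>Y :: real where \<delta>: "0 < \<delta>X" "0 < \<delta>Y" and "\<forall>x\<in>X. \<forall>y\<in>X.
      (\<rho> x y < ennreal \<delta>X \<longrightarrow> \<sigma> (f x) (f y) < ennreal \<epsilon>) \<and>
      (\<sigma> (f x) (f y) < ennreal \<delta>Y \<longrightarrow> \<rho> x y < ennreal \<epsilon>)"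
    unfolding Borel_uc_reduction_def by blast
  then have "\<forall>x\<in>X'. \<forall>y\<in>X'.
      (\<rho> x y < ennreal \<delta>X \<longrightarrow> \<sigma> (f x) (f y) < ennreal \<epsilon>) \<and>
      (\<sigma> (f x) (f y) < ennreal \<delta>Y \<longrightarrow> \<rho> x y < ennreal \<epsilon>)"
    using \<open>X' \<subseteq> X\<close> by blast
  with \<delta> show "\<exists>\<delta>X \<delta>Y. 0 < \<delta>X \<and> 0 < \<delta>Y \<and> (\<forall>x\<in>X'. \<forall>y\<in>X'.
      (\<rho> x y < ennreal \<delta>X \<longrightarrow> \<sigma> (f x) (f y) < ennreal \<epsilon>) \<and>
      (\<sigma> (f x) (f y) < ennreal \<delta>Y \<longrightarrow> \<rho> x y < ennreal \<epsilon>))"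
    by blast
qed

theorem theorem1:
  fixes p q :: real
  assumes "0 < p" and "p < q"
  shows "\<forall>X \<in> {metrics, metrics_ge p, metrics_le q, metrics_between p q}.
         \<forall>Y \<in> {metrics, metrics_ge p, metrics_le q, metrics_between p q}.
           Borel_uc_bireducible X \<rho>_GH Y \<rho>_GH"
proof -
  let ?\<X> = "{metrics, metrics_ge p, metrics_le q, metrics_between p q}"
  \<comment> \<open>The bound \<open>h \<le> p\<close> makes the triangle inequality automatic, and \<open>h \<le> q - p\<close> keeps values below \<open>q\<close>.\<close>
  define h where "h = min p (q - p)"
  have h: "0 < h" "h \<le> p" "p + h \<le> q"
    using assms by (auto simp: h_def)
  have mono: "{f \<in> metrics. range f \<subseteq> A} \<subseteq> {f \<in> metrics. range f \<subseteq> B}" if "A \<subseteq> B" for A B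
    using that by blast
  have "metrics_between p q \<subseteq> metrics_ge p" "metrics_between p q \<subseteq> metrics_le q"
    unfolding metrics_ge_def metrics_le_def metrics_between_def by (intro mono; use assms in auto)+
  moreover have "metrics_ge p \<subseteq> metrics" "metrics_le q \<subseteq> metrics" "metrics_between p q \<subseteq> metrics"
    unfolding metrics_ge_def metrics_le_def metrics_between_def by blast+
  ultimately have subset_metrics: "X \<subseteq> metrics" and superset: "metrics_between p q \<subseteq> X"
    and borel: "X \<in> sets borel" if "X \<in> ?\<X>" for X
    using that metrics_borel metrics_ge_borel metrics_le_borel metrics_between_borel by blast+
  have "Borel_uc_reducible X \<rho>_GH Y \<rho>_GH" if X: "X \<in> ?\<X>" and Y: "Y \<in> ?\<X>" for X Y
    unfolding Borel_uc_reducible_def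
    using analytic_pseudometric_\<rho>_GH[OF borel[OF X] subset_metrics[OF X]]
      analytic_pseudometric_\<rho>_GH[OF borel[OF Y] subset_metrics[OF Y]]
      Borel_uc_reduction_subsets[OF Borel_uc_reduction_ladder_code[OF h] subset_metrics[OF X] superset[OF Y]]
    by blast
  then show ?thesis
    unfolding Borel_uc_bireducible_def by blast
qed

end
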